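(* Let $K$ be the knot $5_2$ and $M=S^3\setminus K$. Let $$V(x,y,\xi)=-\mathrm{Li}_2\!\left(\tfrac1{y\xi}\right)+\mathrm{Li}_2\!\left(\tfrac y\xi\right)-\mathrm{Li}_2\!\left(\tfrac yx\right)+\mathrm{Li}_2\!\left(\tfrac\xi x\right)+\mathrm{Li}_2\!\left(\tfrac x\xi\right)+\log\xi\,\log\frac{x^2}{y^2\xi^6}-\frac{\pi^2}6 .$$ Then $V$ is a potential function for the hyperbolicity equations of $M$ and for the longitude eigenvalue $\eta$, in the following sense: $$x\frac{\partial V}{\partial x}=\log\frac{\xi^2(1-\xi/x)}{(1-y/x)(1-x/\xi)},\qquad y\frac{\partial V}{\partial y}=\log\frac{1-y/x}{\xi^2(1-y/\xi)(1-1/(y\xi))},$$ both of which vanish on the deformation space $\mathcal D$, and on $\mathcal D$ one has $$\xi\frac{\partial V}{\partial \xi}=-\log\eta^2 .$$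
   Context: $\mathrm{Li}_2(z)=-\int_0^z\frac{\log(1-w)}{w}\,dw$ is Euler's dilogarithm. Logarithms and dilogarithms are multivalued: local analytic branches are fixed, and $\log(ab/c)$ for a product of factors stands for the corresponding combination $\log a+\log b-\log c$ of logarithms; equalities between logarithms (including the vanishing) are understood for suitable branches, i.e. modulo $2\pi\sqrt{-1}$. The complement $M$ of $5_2$ has an ideal triangulation with five ideal tetrahedra, whose moduli are parametrized as $y\xi,\ x/\xi,\ x/y,\ \xi/x,\ y/\xi$ with $x,y,\xi\in\mathbb C\setminus\{0\}$ (all moduli different from $0,1$). In these variables the hyperbolicity equations (the product of moduli around each edge is $1$) are equivalent to $$\frac{(1-y/x)(1-x/\xi)}{1-\xi/x}=\frac{1-y/x}{(1-y/\xi)(1-1/(y\xi))}=\xi^2 .$$ The set $\mathcal D$ of solutions $(x,y,\xi)$ of these equations is called the deformation space of hyperbolic structures of $M$. Here $\xi$ is the eigenvalue of the holonomy of the meridian of $K$, and the eigenvalue $\eta$ of the holonomy of the longitude is given on $\mathcal D$ by $$\eta=\frac{y\xi^6}{x}\left(1-\frac1{y\xi}\right)=\frac{y\xi^6}{x}\cdot\frac{1-\xi/x}{(1-x/\xi)(1-y/\xi)} .$$ *)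

theory Defs
  imports "HOL-Complex_Analysis.Complex_Analysis"
begin

subsection \<open>Branches of the logarithm and of the dilogarithm\<close>

text \<open>\<open>log_branch g l W\<close>: \<open>l\<close> is an analytic branch of \<open>log g\<close> on the open set \<open>W\<close>.\<close>

definition log_branch :: "(complex \<Rightarrow> complex) \<Rightarrow> (complex \<Rightarrow> complex) \<Rightarrow> complex set \<Rightarrow> bool" where
  "log_branch g l W \<longleftrightarrow> open W \<and> l holomorphic_on W \<and> (\<forall>z\<in>W. exp (l z) = g z)"

text \<open>The value of \<open>dilog\<close> is meaningful off the cut \<open>[1,\<infinity>)\<close>. The integrand has a removable
  singularity at the starting point \<open>0\<close>.\<close>

definition dilog :: "complex \<Rightarrow> complex" where
  "dilog z = - contour_integral (linepath 0 z) (\<lambda>w. Ln (1 - w) / w)"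

text \<open>\<open>dilog_branch L W\<close>: \<open>L\<close> is a branch of the multivalued dilogarithm on the connected open set
  \<open>W\<close>, that is, \<open>(L, W)\<close> arises from the principal branch by a finite chain of direct analytic
  continuations inside the complement of \<open>{0, 1}\<close>. The point \<open>0\<close> has to be removed because the
  non-principal branches are ramified there. Shrinking the domain is a direct continuation,
  so agreement is required on the whole intersection without loss of generality.\<close>

inductive dilog_branch :: "(complex \<Rightarrow> complex) \<Rightarrow> complex set \<Rightarrow> bool" where
  principal: "dilog_branch dilog (- ({0} \<union> complex_of_real ` {1..}))"
| continuation: "dilog_branch L W \<Longrightarrow> open W' \<Longrightarrow> connected W' \<Longrightarrow> W' \<subseteq> - {0, 1} \<Longrightarrow>
    L' holomorphic_on W' \<Longrightarrow> W \<inter> W' \<noteq> {} \<Longrightarrow> (\<forall>z \<in> W \<inter> W'. L' z = L z) \<Longrightarrow> dilog_branch L' W'"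

definition eq_mod_2pi_i :: "complex \<Rightarrow> complex \<Rightarrow> bool" where
  "eq_mod_2pi_i a b \<longleftrightarrow> (\<exists>k::int. a - b = 2 * of_real pi * \<i> * of_int k)"


subsection \<open>The deformation space of the complement of \<open>5\<^sub>2\<close>\<close>

text \<open>The moduli are those of an ideal triangulation with five tetrahedra. The two equations in
  \<open>deformation_space\<close> are its hyperbolicity equations (product of moduli around each edge equal to
  \<open>1\<close>), already reduced in the coordinates \<open>x, y, \<xi>\<close>, with \<open>\<xi>\<close> the eigenvalue of the meridian.\<close>

definition moduli :: "complex \<Rightarrow> complex \<Rightarrow> complex \<Rightarrow> complex set" where
  "moduli x y \<xi> = {y * \<xi>, x / \<xi>, x / y, \<xi> / x, y / \<xi>}"

definition deformation_space :: "(complex \<times> complex \<times> complex) set" where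
  "deformation_space = {(x, y, \<xi>). x \<noteq> 0 \<and> y \<noteq> 0 \<and> \<xi> \<noteq> 0 \<and> 0 \<notin> moduli x y \<xi> \<and> 1 \<notin> moduli x y \<xi> \<and>
     (1 - y / x) * (1 - x / \<xi>) / (1 - \<xi> / x) = (1 - y / x) / ((1 - y / \<xi>) * (1 - 1 / (y * \<xi>))) \<and>
     (1 - y / x) / ((1 - y / \<xi>) * (1 - 1 / (y * \<xi>))) = \<xi>\<^sup>2}"

definition longitude_eigenvalue :: "complex \<Rightarrow> complex \<Rightarrow> complex \<Rightarrow> complex" where
  "longitude_eigenvalue x y \<xi> = y * \<xi> ^ 6 / x * (1 - 1 / (y * \<xi>))"

lemma longitude_eigenvalue_alt:
  assumes "(x, y, \<xi>) \<in> deformation_space"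
  shows "longitude_eigenvalue x y \<xi> =
    y * \<xi> ^ 6 / x * ((1 - \<xi> / x) / ((1 - x / \<xi>) * (1 - y / \<xi>)))"
proof -
  define a b c d e where "a = 1 - y / x" and "b = 1 - x / \<xi>" and "c = 1 - \<xi> / x"
    and "d = 1 - y / \<xi>" and "e = 1 - 1 / (y * \<xi>)"
  note defs = this
  have nz: "a \<noteq> 0" "b \<noteq> 0" "c \<noteq> 0" "d \<noteq> 0" "e \<noteq> 0" and eq: "a * b / c = a / (d * e)"
    using assms unfolding defs by (auto simp: deformation_space_def moduli_def)
  have "e = c / (b * d)"
    using nz eq by (simp add: field_simps)
  then show ?thesis
    by (simp add: longitude_eigenvalue_def defs)
qed


subsection \<open>The potential function\<close>

text \<open>\<open>L\<^sub>1, \<dots>, L\<^sub>5\<close> are the branches of the dilogarithm at the five arguments and \<open>lx, ly, l\<xi>\<close> the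
  branches of the logarithm at \<open>x, y, \<xi>\<close>. The factor \<open>log (x\<^sup>2 / (y\<^sup>2 \<xi>\<^sup>6))\<close> stands for
  \<open>2 log x - 2 log y - 6 log \<xi>\<close>.\<close>

definition potential ::
  "(complex \<Rightarrow> complex) \<Rightarrow> (complex \<Rightarrow> complex) \<Rightarrow> (complex \<Rightarrow> complex) \<Rightarrow> (complex \<Rightarrow> complex) \<Rightarrow>
   (complex \<Rightarrow> complex) \<Rightarrow> (complex \<Rightarrow> complex) \<Rightarrow> (complex \<Rightarrow> complex) \<Rightarrow> (complex \<Rightarrow> complex) \<Rightarrow>
   complex \<Rightarrow> complex \<Rightarrow> complex \<Rightarrow> complex" where
  "potential L1 L2 L3 L4 L5 lx ly l\<xi> x y \<xi> =
     - L1 (1 / (y * \<xi>)) + L2 (y / \<xi>) - L3 (y / x) + L4 (\<xi> / x) + L5 (x / \<xi>)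
     + l\<xi> \<xi> * (2 * lx x - 2 * ly y - 6 * l\<xi> \<xi>) - (of_real pi)\<^sup>2 / 6"

end

theory Submission
  imports Defs
begin

text \<open>Each branch \<open>L\<close> of the dilogarithm satisfies \<open>exp (- z L'(z)) = 1 - z\<close>: this holds for the
  principal branch and, by the identity theorem, survives analytic continuation. So
  \<open>- z L'(z)\<close> is a branch of \<open>log (1 - z)\<close>, the derivatives of the potential are combinations of
  such branches, and exponentiating them reduces the claims on the deformation space to identities
  of rational functions.\<close>

lemma closed_of_real_atLeast: "closed (complex_of_real ` {a..})"
  by (intro closed_injective_linear_image)
    (auto intro: bounded_linear.linear bounded_linear_of_real inj_of_real)

text \<open>The plane slit along \<open>[1, \<infinity>)\<close> is starlike about \<open>0\<close>,
  so the integrand, once its singularity at \<open>0\<close> is filled in, has a primitive there.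
  The point \<open>0\<close> is excluded because division by zero makes the formula give
  \<open>0\<close> there, whereas the true derivative is \<open>1\<close>.\<close>

lemma dilog_has_field_derivative:
  assumes "z \<notin> complex_of_real ` {1..}" "z \<noteq> 0"
  shows "(dilog has_field_derivative - (Ln (1 - z) / z)) (at z)"
proof -
  define S where "S = - complex_of_real ` {1..}"
  have off_cut: "1 - w \<notin> \<real>\<^sub>\<le>\<^sub>0" if "w \<in> S" for w
  proof
    assume "1 - w \<in> \<real>\<^sub>\<le>\<^sub>0"
    then have "w = of_real (Re w)" "Re w \<ge> 1"
      by (auto simp: complex_nonpos_Reals_iff complex_eq_iff)
    with that show False
      unfolding S_def by (metis ComplD atLeast_iff imageI)
  qed
  have "open S"
    by (simp add: S_def open_Compl closed_of_real_atLeast)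
  \<comment> \<open>If a point \<open>t * w\<close> of the segment were a real
    \<open>r \<ge> 1\<close>, then \<open>w = r / t \<ge> 1\<close> would lie on the cut
    too.\<close>
  have star: "closed_segment 0 w \<subseteq> S" if "w \<in> S" for w
  proof
    fix v assume "v \<in> closed_segment 0 w"
    then obtain t where t: "0 \<le> t" "t \<le> 1" "v = of_real t * w"
      by (auto simp: in_segment scaleR_conv_of_real)
    show "v \<in> S"
    proof (rule ccontr)
      assume "v \<notin> S"
      then obtain r where r: "r \<ge> 1" "v = of_real r"
        by (auto simp: S_def)
      then have "t \<noteq> 0"
        using t by auto
      then have "w = of_real (r / t)"
        using t r by (simp add: field_simps)
      moreover have "r / t \<ge> 1"
        using t r \<open>t \<noteq> 0\<close> by (simp add: field_simps)
      ultimately show False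
        using that by (auto simp: S_def simp del: of_real_divide)
    qed
  qed
  have "0 \<in> S"
    by (auto simp: S_def)
  have "starlike S"
    unfolding starlike_def using star \<open>0 \<in> S\<close> by blast
  \<comment> \<open>Difference quotient of \<open>Ln (1 - w)\<close> at \<open>0\<close>, in the
    shape expected by \<open>pole_lemma_open\<close>. As \<open>Ln 1 = 0\<close>, it is the
    integrand of \<open>dilog\<close> away from \<open>0\<close>.\<close>
  define g where "g = (\<lambda>w::complex.
    if w = 0 then deriv (\<lambda>w. Ln (1 - w)) 0 else (Ln (1 - w) - Ln (1 - 0)) / (w - 0))"
  have "(\<lambda>w. Ln (1 - w)) holomorphic_on S"
    by (intro holomorphic_intros) (use off_cut in auto)
  then have "g holomorphic_on S"
    unfolding g_def using \<open>open S\<close> by (rule pole_lemma_open)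
  then have "continuous_on S g" "\<And>w. w \<in> S - {} \<Longrightarrow> g field_differentiable at w"
    using \<open>open S\<close>
    by (auto intro: holomorphic_on_imp_continuous_on holomorphic_on_imp_differentiable_at)
  then obtain F where F: "\<And>w. w \<in> S \<Longrightarrow> (F has_field_derivative g w) (at w)"
    using holomorphic_starlike_primitive[OF _ \<open>starlike S\<close> \<open>open S\<close> finite.emptyI] by blast
  have "dilog w = F 0 - F w" if "w \<in> S" for w
  proof (cases "w = 0")
    case True
    then show ?thesis
      by (simp add: dilog_def)
  next
    case False
    have "(g has_contour_integral F w - F 0) (linepath 0 w)"
      using contour_integral_primitive[of S F g "linepath 0 w"] F star[OF that]
      by (auto intro: has_field_derivative_at_within)
    \<comment> \<open>The two integrands differ only at the origin, which the segment meets only at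
      parameter \<open>0\<close> since \<open>w \<noteq> 0\<close>.\<close>
    then have "((\<lambda>w. Ln (1 - w) / w) has_contour_integral F w - F 0) (linepath 0 w)"
      unfolding has_contour_integral_linepath
      by (rule has_integral_spike_finite[of "{0}", rotated 2])
        (use False in \<open>auto simp: g_def linepath_def\<close>)
    then show ?thesis
      by (simp add: dilog_def contour_integral_unique)
  qed
  moreover have "z \<in> S"
    using assms by (simp add: S_def)
  moreover have "((\<lambda>w. F 0 - F w) has_field_derivative - (Ln (1 - z) / z)) (at z)"
    using F[OF \<open>z \<in> S\<close>] assms by (auto intro!: derivative_eq_intros simp: g_def)
  ultimately show ?thesis
    using \<open>open S\<close> by (metis has_field_derivative_transform_within_open)
qed

text \<open>Written with \<open>exp\<close>, the relation involves no choice of logarithm, so the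
  same equation passes from each branch to its continuation. The claim \<open>0 \<notin> W\<close>
  is carried along for the later division by \<open>z\<close>.\<close>

lemma dilog_branch_deriv:
  assumes "dilog_branch L W"
  shows "open W \<and> 0 \<notin> W \<and> L holomorphic_on W \<and> (\<forall>z\<in>W. exp (- z * deriv L z) = 1 - z)"
  using assms
proof induction
  case principal
  let ?W = "- ({0} \<union> complex_of_real ` {1..})"
  have "open ?W"
    by (intro open_Compl closed_Un) (auto intro: closed_of_real_atLeast)
  moreover have D: "(dilog has_field_derivative - (Ln (1 - z) / z)) (at z)" if "z \<in> ?W" for z
    using that by (intro dilog_has_field_derivative) auto
  then have "dilog holomorphic_on ?W"
    using \<open>open ?W\<close> holomorphic_on_open by blast
  moreover have "exp (- z * deriv dilog z) = 1 - z" if "z \<in> ?W" for z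
  proof -
    have "z \<noteq> 0" "z \<noteq> 1"
      using that by (auto simp: image_iff dest: bspec[of _ _ 1])
    then show ?thesis
      using DERIV_imp_deriv[OF D[OF that]] by simp
  qed
  ultimately show ?case
    by auto
next
  case (continuation L W W' L')
  \<comment> \<open>The defect of the relation: it vanishes on the nonempty open overlap, where
    \<open>L\<close> and \<open>L'\<close> have equal derivatives, hence on the connected set
    \<open>W'\<close>.\<close>
  define f where "f = (\<lambda>z. exp (- z * deriv L' z) - (1 - z))"
  have "f holomorphic_on W'"
    unfolding f_def using continuation by (intro holomorphic_intros) auto
  moreover have "f z = 0" if "z \<in> W \<inter> W'" for z
  proof -
    have "deriv L' z = deriv L z"
      using continuation that
      by (intro complex_derivative_transform_within_open[of _ "W \<inter> W'"])
        (auto intro: holomorphic_on_subset)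
    with that continuation show ?thesis
      by (simp add: f_def)
  qed
  ultimately have "f z = 0" if "z \<in> W'" for z
    using analytic_continuation_open[of "W \<inter> W'" W' f "\<lambda>_. 0"] continuation that
    by (auto intro: open_Int)
  with continuation show ?case
    by (auto simp: f_def)
qed

text \<open>The witness is \<open>- z * deriv L z\<close>, which makes the derivative formula a
  tautology away from \<open>0\<close>; that it is a logarithm of \<open>1 - z\<close> is the
  preceding lemma.\<close>

lemma dilog_branch_obtain_log:
  assumes "dilog_branch L W"
  obtains m where "log_branch (\<lambda>z. 1 - z) m W"
    and "\<And>z. z \<in> W \<Longrightarrow> (L has_field_derivative - (m z / z)) (at z)"
proof
  note * = dilog_branch_deriv[OF assms]
  show "log_branch (\<lambda>z. 1 - z) (\<lambda>z. - z * deriv L z) W"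
    unfolding log_branch_def using * by (auto intro!: holomorphic_intros)
  show "(L has_field_derivative - (- z * deriv L z / z)) (at z)" if "z \<in> W" for z
    using * that by (auto intro: holomorphic_derivI)
qed

text \<open>Differentiating \<open>exp (l w) = w\<close> gives \<open>z * deriv l z = 1\<close>,
  which also forces \<open>z \<noteq> 0\<close>.\<close>

lemma log_branch_has_field_derivative:
  assumes "log_branch (\<lambda>z. z) l W" "z \<in> W"
  shows "(l has_field_derivative 1 / z) (at z)"
proof -
  have W: "open W" "l holomorphic_on W" and l: "\<And>w. w \<in> W \<Longrightarrow> exp (l w) = w"
    using assms by (auto simp: log_branch_def)
  have D: "(l has_field_derivative deriv l z) (at z)"
    using W assms by (auto intro: holomorphic_derivI)
  then have "((\<lambda>w. exp (l w)) has_field_derivative exp (l z) * deriv l z) (at z)"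
    by (auto intro!: derivative_eq_intros)
  then have "((\<lambda>w. w) has_field_derivative exp (l z) * deriv l z) (at z)"
    by (rule has_field_derivative_transform_within_open[OF _ W(1) assms(2) l])
  then have "z * deriv l z = 1"
    using DERIV_unique[OF _ DERIV_ident] l[OF assms(2)] by auto
  then have "deriv l z = 1 / z"
    by (metis mult_zero_left nonzero_mult_div_cancel_left zero_neq_one)
  with D show ?thesis
    by simp
qed

text \<open>Reduces every congruence between sums of logarithms to an equality between
  products.\<close>

lemma eq_mod_2pi_i_iff_exp_eq: "eq_mod_2pi_i a b \<longleftrightarrow> exp a = exp b"
  unfolding eq_mod_2pi_i_def exp_eq by (auto simp: algebra_simps)

text \<open>The branches \<open>m1\<close> to \<open>m5\<close> are chosen before the points, so the
  same five analytic functions serve everywhere. In the last congruence the principal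
  \<open>Ln\<close> is harmless, since only its class modulo \<open>2 \<pi> \<i>\<close>
  matters.\<close>

theorem mainTheorem1:
  fixes L1 L2 L3 L4 L5 lx ly l\<xi> :: "complex \<Rightarrow> complex"
    and W1 W2 W3 W4 W5 X Y Z :: "complex set"
  defines "V \<equiv> potential L1 L2 L3 L4 L5 lx ly l\<xi>"
  assumes "dilog_branch L1 W1" and "dilog_branch L2 W2" and "dilog_branch L3 W3"
    and "dilog_branch L4 W4" and "dilog_branch L5 W5"
    and "log_branch (\<lambda>z. z) lx X" and "log_branch (\<lambda>z. z) ly Y" and "log_branch (\<lambda>z. z) l\<xi> Z"
  shows "\<exists>m1 m2 m3 m4 m5.
    log_branch (\<lambda>z. 1 - z) m1 W1 \<and> log_branch (\<lambda>z. 1 - z) m2 W2 \<and> log_branch (\<lambda>z. 1 - z) m3 W3 \<and>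
    log_branch (\<lambda>z. 1 - z) m4 W4 \<and> log_branch (\<lambda>z. 1 - z) m5 W5 \<and>
    (\<forall>x\<in>X. \<forall>y\<in>Y. \<forall>\<xi>\<in>Z.
      1 / (y * \<xi>) \<in> W1 \<and> y / \<xi> \<in> W2 \<and> y / x \<in> W3 \<and> \<xi> / x \<in> W4 \<and> x / \<xi> \<in> W5 \<longrightarrow>
      (\<lambda>t. V t y \<xi>) field_differentiable at x \<and>
      (\<lambda>t. V x t \<xi>) field_differentiable at y \<and>
      (\<lambda>t. V x y t) field_differentiable at \<xi> \<and>
      x * deriv (\<lambda>t. V t y \<xi>) x = 2 * l\<xi> \<xi> + m4 (\<xi> / x) - m3 (y / x) - m5 (x / \<xi>) \<and>
      y * deriv (\<lambda>t. V x t \<xi>) y = m3 (y / x) - 2 * l\<xi> \<xi> - m2 (y / \<xi>) - m1 (1 / (y * \<xi>)) \<and>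
      ((x, y, \<xi>) \<in> deformation_space \<longrightarrow>
        eq_mod_2pi_i (x * deriv (\<lambda>t. V t y \<xi>) x) 0 \<and>
        eq_mod_2pi_i (y * deriv (\<lambda>t. V x t \<xi>) y) 0 \<and>
        eq_mod_2pi_i (\<xi> * deriv (\<lambda>t. V x y t) \<xi>) (- Ln ((longitude_eigenvalue x y \<xi>)\<^sup>2))))"
proof -
  obtain m1 where m1: "log_branch (\<lambda>z. 1 - z) m1 W1"
    and D1: "\<And>z. z \<in> W1 \<Longrightarrow> (L1 has_field_derivative - (m1 z / z)) (at z)"
    using dilog_branch_obtain_log[OF \<open>dilog_branch L1 W1\<close>] by blast
  obtain m2 where m2: "log_branch (\<lambda>z. 1 - z) m2 W2"
    and D2: "\<And>z. z \<in> W2 \<Longrightarrow> (L2 has_field_derivative - (m2 z / z)) (at z)"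
    using dilog_branch_obtain_log[OF \<open>dilog_branch L2 W2\<close>] by blast
  obtain m3 where m3: "log_branch (\<lambda>z. 1 - z) m3 W3"
    and D3: "\<And>z. z \<in> W3 \<Longrightarrow> (L3 has_field_derivative - (m3 z / z)) (at z)"
    using dilog_branch_obtain_log[OF \<open>dilog_branch L3 W3\<close>] by blast
  obtain m4 where m4: "log_branch (\<lambda>z. 1 - z) m4 W4"
    and D4: "\<And>z. z \<in> W4 \<Longrightarrow> (L4 has_field_derivative - (m4 z / z)) (at z)"
    using dilog_branch_obtain_log[OF \<open>dilog_branch L4 W4\<close>] by blast
  obtain m5 where m5: "log_branch (\<lambda>z. 1 - z) m5 W5"
    and D5: "\<And>z. z \<in> W5 \<Longrightarrow> (L5 has_field_derivative - (m5 z / z)) (at z)"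
    using dilog_branch_obtain_log[OF \<open>dilog_branch L5 W5\<close>] by blast
  note lx = \<open>log_branch (\<lambda>z. z) lx X\<close> and ly = \<open>log_branch (\<lambda>z. z) ly Y\<close>
    and l\<xi> = \<open>log_branch (\<lambda>z. z) l\<xi> Z\<close>
  show ?thesis
  proof (rule exI[of _ m1], rule exI[of _ m2], rule exI[of _ m3], rule exI[of _ m4], rule exI[of _ m5],
      intro conjI ballI impI m1 m2 m3 m4 m5)
    fix x y \<xi>
    assume X: "x \<in> X" and Y: "y \<in> Y" and Z: "\<xi> \<in> Z"
      and "1 / (y * \<xi>) \<in> W1 \<and> y / \<xi> \<in> W2 \<and> y / x \<in> W3 \<and> \<xi> / x \<in> W4 \<and> x / \<xi> \<in> W5"
    then have W: "1 / (y * \<xi>) \<in> W1" "y / \<xi> \<in> W2" "y / x \<in> W3" "\<xi> / x \<in> W4" "x / \<xi> \<in> W5"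
      by auto
    have exp_l: "exp (lx x) = x" "exp (ly y) = y" "exp (l\<xi> \<xi>) = \<xi>"
      using X Y Z lx ly l\<xi> by (auto simp: log_branch_def)
    have exp_m: "exp (m1 (1 / (y * \<xi>))) = 1 - 1 / (y * \<xi>)" "exp (m2 (y / \<xi>)) = 1 - y / \<xi>"
      "exp (m3 (y / x)) = 1 - y / x" "exp (m4 (\<xi> / x)) = 1 - \<xi> / x" "exp (m5 (x / \<xi>)) = 1 - x / \<xi>"
      using W m1 m2 m3 m4 m5 by (auto simp: log_branch_def)
    have nz: "x \<noteq> 0" "y \<noteq> 0" "\<xi> \<noteq> 0"
      using exp_l by (metis exp_not_eq_zero)+
    note Dx = log_branch_has_field_derivative[OF lx X]
      and Dy = log_branch_has_field_derivative[OF ly Y]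
      and D\<xi> = log_branch_has_field_derivative[OF l\<xi> Z]
    \<comment> \<open>Chain rules with each \<open>L\<close> as outer function, for use as
      introduction rules beside \<open>derivative_eq_intros\<close>.\<close>
    note chain = DERIV_chain2[OF D1] DERIV_chain2[OF D2] DERIV_chain2[OF D3] DERIV_chain2[OF D4]
      DERIV_chain2[OF D5]
    \<comment> \<open>Each dilogarithm argument is a monomial, so a term \<open>L g\<close>
      contributes minus the exponent of the differentiated variable in \<open>g\<close> times the
      branch of \<open>log (1 - g)\<close>. The remaining terms come from the product of logarithms;
      in \<open>d\<xi>\<close> the coefficient \<open>-12\<close> arises from differentiating
      \<open>- 6 * l\<xi> \<xi> * l\<xi> \<xi>\<close>.\<close>
    define dx where "dx = 2 * l\<xi> \<xi> + m4 (\<xi> / x) - m3 (y / x) - m5 (x / \<xi>)"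
    define dy where "dy = m3 (y / x) - 2 * l\<xi> \<xi> - m2 (y / \<xi>) - m1 (1 / (y * \<xi>))"
    define d\<xi> where "d\<xi> = m2 (y / \<xi>) + m5 (x / \<xi>) - m1 (1 / (y * \<xi>)) - m4 (\<xi> / x)
      + 2 * lx x - 2 * ly y - 12 * l\<xi> \<xi>"
    have Vx: "((\<lambda>t. V t y \<xi>) has_field_derivative dx / x) (at x)"
      unfolding V_def potential_def dx_def using nz
      by (auto intro!: derivative_eq_intros chain Dx simp: W divide_simps power2_eq_square)
    have Vy: "((\<lambda>t. V x t \<xi>) has_field_derivative dy / y) (at y)"
      unfolding V_def potential_def dy_def using nz
      by (auto intro!: derivative_eq_intros chain Dy simp: W divide_simps power2_eq_square)
    have V\<xi>: "((\<lambda>t. V x y t) has_field_derivative d\<xi> / \<xi>) (at \<xi>)"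
      unfolding V_def potential_def d\<xi>_def using nz
      by (auto intro!: derivative_eq_intros chain D\<xi> simp: W divide_simps power2_eq_square)
    show "(\<lambda>t. V t y \<xi>) field_differentiable at x" "(\<lambda>t. V x t \<xi>) field_differentiable at y"
      "(\<lambda>t. V x y t) field_differentiable at \<xi>"
      using Vx Vy V\<xi> field_differentiable_def by blast+
    have derivs: "x * deriv (\<lambda>t. V t y \<xi>) x = dx" "y * deriv (\<lambda>t. V x t \<xi>) y = dy"
      "\<xi> * deriv (\<lambda>t. V x y t) \<xi> = d\<xi>"
      using Vx Vy V\<xi> nz by (simp_all add: DERIV_imp_deriv)
    show "x * deriv (\<lambda>t. V t y \<xi>) x = 2 * l\<xi> \<xi> + m4 (\<xi> / x) - m3 (y / x) - m5 (x / \<xi>)"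
      "y * deriv (\<lambda>t. V x t \<xi>) y = m3 (y / x) - 2 * l\<xi> \<xi> - m2 (y / \<xi>) - m1 (1 / (y * \<xi>))"
      by (simp_all add: derivs flip: dx_def dy_def)
    assume D: "(x, y, \<xi>) \<in> deformation_space"
    \<comment> \<open>Naming the factors keeps \<open>field_simps\<close> from expanding them, so
      that they cancel as atoms.\<close>
    define a b c d e where "a = 1 - y / x" and "b = 1 - x / \<xi>" and "c = 1 - \<xi> / x"
      and "d = 1 - y / \<xi>" and "e = 1 - 1 / (y * \<xi>)"
    note factors = this
    \<comment> \<open>No modulus is \<open>1\<close>; for \<open>a\<close> and \<open>e\<close> this
      is applied to the inverses of the moduli \<open>x / y\<close> and
      \<open>y * \<xi>\<close>.\<close>
    have factors_nz: "a \<noteq> 0" "b \<noteq> 0" "c \<noteq> 0" "d \<noteq> 0" "e \<noteq> 0"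
      and eqs: "a * b / c = \<xi>\<^sup>2" "a / (d * e) = \<xi>\<^sup>2"
      using D unfolding factors by (auto simp: deformation_space_def moduli_def)
    note exp_simps = exp_add exp_diff exp_double exp_l exp_m[folded factors]
    have "exp dx = \<xi>\<^sup>2 * c / a / b"
      by (simp add: dx_def exp_simps)
    also have "\<dots> = 1"
      using factors_nz eqs(1) nz by (simp add: field_simps)
    finally show "eq_mod_2pi_i (x * deriv (\<lambda>t. V t y \<xi>) x) 0"
      by (simp add: derivs eq_mod_2pi_i_iff_exp_eq)
    have "exp dy = a / \<xi>\<^sup>2 / d / e"
      by (simp add: dy_def exp_simps)
    also have "\<dots> = 1"
      using factors_nz eqs(2) nz by (simp add: field_simps)
    finally show "eq_mod_2pi_i (y * deriv (\<lambda>t. V x t \<xi>) y) 0"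
      by (simp add: derivs eq_mod_2pi_i_iff_exp_eq)
    let ?\<eta> = "longitude_eigenvalue x y \<xi>"
    \<comment> \<open>Each of \<open>b\<close>, \<open>c\<close>, \<open>d\<close>, \<open>e\<close>
      enters \<open>exp d\<xi>\<close> exactly once, so the square of the eigenvalue is formed as
      the product of its two different expressions.\<close>
    have \<eta>: "?\<eta> = y * \<xi> ^ 6 / x * e" and \<eta>': "?\<eta> = y * \<xi> ^ 6 / x * (c / (b * d))"
      using longitude_eigenvalue_alt[OF D] by (simp_all add: longitude_eigenvalue_def factors)
    have "?\<eta> \<noteq> 0"
      using \<eta> nz factors_nz by simp
    \<comment> \<open>\<open>exp_double\<close> handles only the coefficient \<open>2\<close>;
      \<open>12\<close> is treated as a natural multiple.\<close>
    have "exp (12 * l\<xi> \<xi>) = \<xi> ^ 12"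
      using exp_of_nat_mult[of 12 "l\<xi> \<xi>"] exp_l by simp
    then have "exp d\<xi> = d * b / e / c * x\<^sup>2 / y\<^sup>2 / \<xi> ^ 12"
      by (simp add: d\<xi>_def exp_simps)
    also have "\<dots> = inverse ((y * \<xi> ^ 6 / x * e) * (y * \<xi> ^ 6 / x * (c / (b * d))))"
      using nz factors_nz by (simp add: field_simps power2_eq_square flip: power_add)
    also have "\<dots> = inverse (?\<eta>\<^sup>2)"
      by (simp only: power2_eq_square flip: \<eta> \<eta>')
    also have "\<dots> = exp (- Ln (?\<eta>\<^sup>2))"
      using \<open>?\<eta> \<noteq> 0\<close> by (simp add: exp_minus)
    finally show "eq_mod_2pi_i (\<xi> * deriv (\<lambda>t. V x y t) \<xi>) (- Ln (?\<eta>\<^sup>2))"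
      by (simp add: derivs eq_mod_2pi_i_iff_exp_eq)
  qed
qed

end
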